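(* Let $E$ be a separable Banach space, $f:\Omega\times E\to\overline{\mathbb{R}}$ a measurable integrand and $x_0\in L_\infty(\Omega,E)$ with $f(\omega,x_0(\omega))$ finite for almost every $\omega$. Suppose that there exist $\eta>0$ and an integrable function $c$ such that, for almost every $\omega$ and every $e\in E$, $$\|e\|\le\eta\ \Longrightarrow\ f_\omega(x_0(\omega)+e)-f_\omega(x_0(\omega))\ge-c(\omega)\|e\| .$$ Then the integrand $f$ has the Fréchet-differential lower compactness property on $L_\infty(\Omega,E)$ at the point $x_0$.
   Context: $(\Omega,\mathbb{T},\mu)$ is a measure space with $\mu$ a $\sigma$-finite positive measure and $\mathbb{T}$ $\mu$-complete. A measurable integrand is a $\mathbb{T}\otimes\mathcal{B}(E)$-measurable function; $f_\omega=f(\omega,\cdot)$. A subset $X$ of $L_1(\Omega,\mathbb{R})$ is uniformly integrable if it is bounded in $L_1$ and for every $\epsilon>0$ there are $\eta>0$ and a measurable $K$ of finite measure with $\sup_{u\in X}\|u1_A\|_1<\epsilon$ whenever $\mu(A)\le\eta$, and $\sup_{u\in X}\|u1_{K^c}\|_1<\epsilon$. $f$ has the Fréchet-differential lower compactness property on $L_\infty(\Omega,E)$ at $x_0$ if for every sequence $(r_n)_n$ of positive numbers converging to $0$ and every norm bounded sequence $(x_n)_n$ in $L_\infty(\Omega,E)$ there is $n_0$ such that the negative parts of $\omega\mapsto r_n^{-1}(f(\omega,x_0(\omega)+r_nx_n(\omega))-f(\omega,x_0(\omega)))$, $n\ge n_0$, form a uniformly integrable family in $L_1(\Omega,\mathbb{R})$.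 *)

theory Defs
  imports "HOL-Analysis.Analysis" "HOL-Probability.Essential_Supremum"
begin

text \<open>
  Elements of the spaces \<open>L\<^sub>1\<close> and \<open>L\<^sub>\<infinity>\<close> are represented by measurable functions, without
  passing to classes modulo almost everywhere equality. Separable Banach spaces are the types of
  sort \<open>{banach, second_countable_topology}\<close>; for them strong measurability is Borel
  measurability. The norms take values in \<^typ>\<open>ennreal\<close>.
\<close>

definition L1_norm :: "'a measure \<Rightarrow> ('a \<Rightarrow> real) \<Rightarrow> ennreal" where
  "L1_norm M u = (\<integral>\<^sup>+ \<omega>. ennreal \<bar>u \<omega>\<bar> \<partial>M)"

definition Linf_norm :: "'a measure \<Rightarrow> ('a \<Rightarrow> 'e::real_normed_vector) \<Rightarrow> ennreal" where
  "Linf_norm M x = esssup M (\<lambda>\<omega>. ennreal (norm (x \<omega>)))"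

definition Linf :: "'a measure \<Rightarrow> ('a \<Rightarrow> 'e::{banach, second_countable_topology}) set" where
  "Linf M = {x \<in> borel_measurable M. Linf_norm M x < \<infinity>}"

definition measurable_integrand ::
  "'a measure \<Rightarrow> ('a \<Rightarrow> 'e::{banach, second_countable_topology} \<Rightarrow> ereal) \<Rightarrow> bool" where
  "measurable_integrand M f \<longleftrightarrow> (\<lambda>(\<omega>, e). f \<omega> e) \<in> borel_measurable (M \<Otimes>\<^sub>M borel)"

definition uniformly_integrable :: "'a measure \<Rightarrow> ('a \<Rightarrow> real) set \<Rightarrow> bool" where
  "uniformly_integrable M X \<longleftrightarrow>
     (\<forall>u\<in>X. integrable M u) \<and>
     (SUP u\<in>X. L1_norm M u) < \<infinity> \<and>
     (\<forall>\<epsilon>::real. \<epsilon> > 0 \<longrightarrow>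
       (\<exists>\<eta>::real. \<eta> > 0 \<and> (\<exists>K\<in>sets M. emeasure M K < \<infinity> \<and>
          (\<forall>A\<in>sets M. emeasure M A \<le> ennreal \<eta> \<longrightarrow>
             (SUP u\<in>X. L1_norm M (\<lambda>\<omega>. u \<omega> * indicator A \<omega>)) < ennreal \<epsilon>) \<and>
          (SUP u\<in>X. L1_norm M (\<lambda>\<omega>. u \<omega> * indicator (space M - K) \<omega>)) < ennreal \<epsilon>)))"

definition neg_part_quotient ::
  "('a \<Rightarrow> 'e::real_vector \<Rightarrow> ereal) \<Rightarrow> ('a \<Rightarrow> 'e) \<Rightarrow> real \<Rightarrow> ('a \<Rightarrow> 'e) \<Rightarrow> 'a \<Rightarrow> ereal" where
  "neg_part_quotient f x0 r x \<omega> =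
     max 0 (- (ereal (inverse r) * (f \<omega> (x0 \<omega> + r *\<^sub>R x \<omega>) - f \<omega> (x0 \<omega>))))"

text \<open>
  The negative parts may take the value \<open>\<infinity>\<close>. Belonging to \<open>L\<^sub>1(\<Omega>, \<real>)\<close> includes being finite
  almost everywhere; this is required explicitly because \<open>real_of_ereal \<infinity> = 0\<close>.
\<close>

definition frechet_diff_lower_compactness ::
  "'a measure \<Rightarrow> ('a \<Rightarrow> 'e::{banach, second_countable_topology} \<Rightarrow> ereal) \<Rightarrow> ('a \<Rightarrow> 'e) \<Rightarrow> bool" where
  "frechet_diff_lower_compactness M f x0 \<longleftrightarrow>
     (\<forall>(r :: nat \<Rightarrow> real) (x :: nat \<Rightarrow> 'a \<Rightarrow> 'e).
        (\<forall>n. r n > 0) \<longrightarrow> r \<longlonglongrightarrow> 0 \<longrightarrow>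
        (\<forall>n. x n \<in> Linf M) \<longrightarrow> (SUP n. Linf_norm M (x n)) < \<infinity> \<longrightarrow>
        (\<exists>n0.
           (\<forall>n\<ge>n0. AE \<omega> in M. neg_part_quotient f x0 (r n) (x n) \<omega> < \<infinity>) \<and>
           uniformly_integrable M
             ((\<lambda>n \<omega>. real_of_ereal (neg_part_quotient f x0 (r n) (x n) \<omega>)) ` {n0..})))"

end

theory Submission
  imports Defs
begin

text \<open>
  The hypothesis is a minorant, linear in the norm, of the increments of \<open>f \<omega>\<close> on the ball of radius \<open>\<eta>\<close>. If
  \<open>b\<close> is an essential bound of all the functions \<open>x n\<close>, then \<open>r n * b \<le> \<eta>\<close> for all large \<open>n\<close>, so the minorant applies
  to the increments \<open>r n *\<^sub>R x n \<omega>\<close>; dividing by \<open>r n\<close> cancels the factor \<open>r n\<close> in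
  \<open>c \<omega> * norm (r n *\<^sub>R x n \<omega>)\<close>. Hence the negative parts of these difference quotients are
  bounded almost everywhere by the function \<open>b * \<bar>c \<omega>\<bar>\<close>, which is integrable and the same for all \<open>n\<close>
  (\<open>neg_part_quotient_le\<close>). A family of measurable functions with a common integrable bound is
  uniformly integrable (\<open>uniformly_integrable_dominated\<close>).

  Both smallness conditions in uniform integrability come from one fact
  (\<open>integral_outside_level_band_small\<close>): the integral of an integrable \<open>g\<close> is carried, up to
  \<open>\<epsilon>\<close>, by a set on which \<open>g\<close> lies between two positive constants. Being bounded
  away from \<open>0\<close> gives this set finite measure, and being bounded above makes the integral of
  \<open>g\<close> over the part of a set \<open>A\<close> inside it at most a multiple of the measure of \<open>A\<close>.
\<close>

text \<open>
  The bands exhaust the set where \<open>g\<close> is not \<open>0\<close>, so dominated convergence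
  makes the integral outside them tend to \<open>0\<close>. The bounds use \<open>Suc n\<close> so that \<open>n = 0\<close>
  causes no division by zero.
\<close>
lemma integral_outside_level_band_small:
  fixes g :: "'a \<Rightarrow> real" and \<epsilon> :: real
  assumes g: "integrable M g" and nonneg: "\<And>\<omega>. 0 \<le> g \<omega>" and "\<epsilon> > 0"
  obtains n :: nat where
    "(\<integral>\<omega>. g \<omega> * indicator (space M - {\<omega> \<in> space M. 1 / Suc n \<le> g \<omega> \<and> g \<omega> \<le> Suc n}) \<omega> \<partial>M) < \<epsilon>"
proof -
  define K where "K n = {\<omega> \<in> space M. 1 / Suc n \<le> g \<omega> \<and> g \<omega> \<le> Suc n}" for n
  have [measurable]: "g \<in> borel_measurable M" using g by auto
  have K[measurable]: "K n \<in> sets M" for n unfolding K_def by measurable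
  have "(\<lambda>n. \<integral>\<omega>. g \<omega> * indicator (space M - K n) \<omega> \<partial>M) \<longlonglongrightarrow> (\<integral>\<omega>. 0 \<partial>M)"
  proof (rule integral_dominated_convergence[OF _ _ g])
    show "AE \<omega> in M. (\<lambda>n. g \<omega> * indicator (space M - K n) \<omega>) \<longlonglongrightarrow> 0"
    proof (rule AE_I2)
      fix \<omega> assume \<omega>: "\<omega> \<in> space M"
      show "(\<lambda>n. g \<omega> * indicator (space M - K n) \<omega>) \<longlonglongrightarrow> 0"
      proof (cases "g \<omega> = 0")
        case False
        then have pos: "g \<omega> > 0" using nonneg[of \<omega>] by simp
        have "(\<lambda>n. 1 / real (Suc n)) \<longlonglongrightarrow> 0" by real_asymp
        then have low: "\<forall>\<^sub>F n in sequentially. 1 / real (Suc n) < g \<omega>"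
          using pos by (rule order_tendstoD)
        have up: "\<forall>\<^sub>F n in sequentially. g \<omega> \<le> real (Suc n)"
          by real_asymp
        have "\<forall>\<^sub>F n in sequentially. g \<omega> * indicator (space M - K n) \<omega> = 0"
          using low up by eventually_elim (use \<omega> in \<open>auto simp: K_def\<close>)
        then show ?thesis by (rule tendsto_eventually)
      qed simp
    qed
  qed (auto simp: nonneg indicator_def)
  then have "\<forall>\<^sub>F n in sequentially. (\<integral>\<omega>. g \<omega> * indicator (space M - K n) \<omega> \<partial>M) < \<epsilon>"
    using \<open>\<epsilon> > 0\<close> by (intro order_tendstoD(2)) auto
  then obtain n where "(\<integral>\<omega>. g \<omega> * indicator (space M - K n) \<omega> \<partial>M) < \<epsilon>"
    by (auto simp: eventually_sequentially)
  then show ?thesis using that by (simp add: K_def)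
qed

lemma L1_norm_indicator_le:
  assumes "AE \<omega> in M. \<bar>u \<omega>\<bar> \<le> g \<omega>"
  shows "L1_norm M (\<lambda>\<omega>. u \<omega> * indicator A \<omega>) \<le> (\<integral>\<^sup>+ \<omega>. ennreal (g \<omega>) * indicator A \<omega> \<partial>M)"
  unfolding L1_norm_def
  by (rule nn_integral_mono_AE) (use assms in \<open>auto simp: indicator_def ennreal_leI\<close>)

text \<open>
  Let \<open>K\<close> be a band outside which \<open>g\<close> has integral below \<open>\<epsilon> / 2\<close>, and \<open>m\<close> an upper bound of
  \<open>g\<close> on \<open>K\<close>. The integral of \<open>g\<close> over a set \<open>A\<close> is then at most \<open>\<epsilon> / 2\<close> plus \<open>m\<close> times the
  measure of \<open>A\<close>.
\<close>
lemma uniformly_integrable_dominated: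
  fixes g :: "'a \<Rightarrow> real" and X :: "('a \<Rightarrow> real) set"
  assumes g: "integrable M g" and nonneg: "\<And>\<omega>. 0 \<le> g \<omega>"
    and meas: "\<And>u. u \<in> X \<Longrightarrow> u \<in> borel_measurable M"
    and dom: "\<And>u. u \<in> X \<Longrightarrow> AE \<omega> in M. \<bar>u \<omega>\<bar> \<le> g \<omega>"
  shows "uniformly_integrable M X"
  unfolding uniformly_integrable_def
proof (intro conjI ballI allI impI)
  have [measurable]: "g \<in> borel_measurable M" using g by auto
  show "integrable M u" if "u \<in> X" for u
    by (rule Bochner_Integration.integrable_bound[OF g meas[OF that]])
      (use dom[OF that] nonneg in auto)
  have "(SUP u\<in>X. L1_norm M u) \<le> (\<integral>\<^sup>+ \<omega>. ennreal (g \<omega>) \<partial>M)"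
    unfolding L1_norm_def
    by (intro SUP_least nn_integral_mono_AE eventually_mono[OF dom] ennreal_leI)
  also have "\<dots> < \<infinity>"
    using g nonneg by (simp add: nn_integral_eq_integral)
  finally show "(SUP u\<in>X. L1_norm M u) < \<infinity>" .

  fix \<epsilon> :: real assume \<epsilon>: "\<epsilon> > 0"
  then have "\<epsilon> / 2 > 0" by simp
  then obtain n where n: "(\<integral>\<omega>. g \<omega> * indicator
      (space M - {\<omega> \<in> space M. 1 / Suc n \<le> g \<omega> \<and> g \<omega> \<le> Suc n}) \<omega> \<partial>M) < \<epsilon> / 2"
    using integral_outside_level_band_small[OF g nonneg] by blast
  define m where "m = real (Suc n)"
  define K where "K = {\<omega> \<in> space M. 1 / m \<le> g \<omega> \<and> g \<omega> \<le> m}"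
  have m: "m > 0" by (simp add: m_def)
  have [measurable]: "K \<in> sets M" unfolding K_def by measurable
  have "integrable M (\<lambda>\<omega>. g \<omega> * indicator (space M - K) \<omega>)"
    using g by (intro integrable_real_mult_indicator) auto
  then have "(\<integral>\<^sup>+ \<omega>. ennreal (g \<omega> * indicator (space M - K) \<omega>) \<partial>M)
      = ennreal (\<integral>\<omega>. g \<omega> * indicator (space M - K) \<omega> \<partial>M)"
    by (intro nn_integral_eq_integral) (auto simp: nonneg)
  also have "\<dots> < ennreal (\<epsilon> / 2)"
    using n \<epsilon> by (auto intro!: ennreal_lessI simp: K_def m_def)
  also have "(\<lambda>\<omega>. ennreal (g \<omega> * indicator (space M - K) \<omega>))
      = (\<lambda>\<omega>. ennreal (g \<omega>) * indicator (space M - K) \<omega>)"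
    by (auto simp: indicator_def)
  finally have tail: "(\<integral>\<^sup>+ \<omega>. ennreal (g \<omega>) * indicator (space M - K) \<omega> \<partial>M) < ennreal (\<epsilon> / 2)" .

  have K_finite: "emeasure M K < \<infinity>"
  proof -
    have "emeasure M K = (\<integral>\<^sup>+ \<omega>. indicator K \<omega> \<partial>M)" by simp
    also have "\<dots> \<le> (\<integral>\<^sup>+ \<omega>. ennreal (m * g \<omega>) \<partial>M)"
    proof (rule nn_integral_mono)
      fix \<omega>
      have "1 \<le> m * g \<omega>" if "\<omega> \<in> K"
        using that m by (simp add: K_def field_simps)
      then show "indicator K \<omega> \<le> ennreal (m * g \<omega>)"
        by (auto simp: indicator_def)
    qed
    also have "\<dots> < \<infinity>"
      using g nonneg m by (subst nn_integral_eq_integral) auto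
    finally show ?thesis .
  qed

  have small: "(SUP u\<in>X. L1_norm M (\<lambda>\<omega>. u \<omega> * indicator A \<omega>)) < ennreal \<epsilon>"
    if A: "A \<in> sets M" "emeasure M A \<le> ennreal (\<epsilon> / (2 * m))" for A
  proof -
    note A(1)[measurable]
    have "(SUP u\<in>X. L1_norm M (\<lambda>\<omega>. u \<omega> * indicator A \<omega>))
        \<le> (\<integral>\<^sup>+ \<omega>. ennreal (g \<omega>) * indicator A \<omega> \<partial>M)"
      by (intro SUP_least L1_norm_indicator_le dom)
    also have "\<dots> \<le> (\<integral>\<^sup>+ \<omega>. ennreal (g \<omega>) * indicator (space M - K) \<omega>
        + ennreal m * indicator A \<omega> \<partial>M)"
      by (intro nn_integral_mono) (auto simp: indicator_def K_def ennreal_leI)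
    also have "\<dots> = (\<integral>\<^sup>+ \<omega>. ennreal (g \<omega>) * indicator (space M - K) \<omega> \<partial>M)
        + ennreal m * emeasure M A"
      by (subst nn_integral_add) (auto simp: nn_integral_cmult_indicator)
    also have "\<dots> \<le> (\<integral>\<^sup>+ \<omega>. ennreal (g \<omega>) * indicator (space M - K) \<omega> \<partial>M)
        + ennreal m * ennreal (\<epsilon> / (2 * m))"
      by (intro add_left_mono mult_left_mono A) auto
    also have "ennreal m * ennreal (\<epsilon> / (2 * m)) = ennreal (\<epsilon> / 2)"
      using m \<epsilon> by (simp flip: ennreal_mult)
    also have "(\<integral>\<^sup>+ \<omega>. ennreal (g \<omega>) * indicator (space M - K) \<omega> \<partial>M) + ennreal (\<epsilon> / 2)
        < ennreal (\<epsilon> / 2) + ennreal (\<epsilon> / 2)"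
      using tail by (simp add: ennreal_add_left_cancel_less add.commute)
    also have "\<dots> = ennreal \<epsilon>"
      using \<epsilon> by (simp flip: ennreal_plus)
    finally show ?thesis .
  qed

  have "(SUP u\<in>X. L1_norm M (\<lambda>\<omega>. u \<omega> * indicator (space M - K) \<omega>)) \<le> ennreal (\<epsilon> / 2)"
    using tail by (intro SUP_least order.trans[OF L1_norm_indicator_le[OF dom]]) auto
  also have "\<dots> < ennreal \<epsilon>"
    using \<epsilon> by (intro ennreal_lessI) auto
  finally have outside:
    "(SUP u\<in>X. L1_norm M (\<lambda>\<omega>. u \<omega> * indicator (space M - K) \<omega>)) < ennreal \<epsilon>" .

  show "\<exists>\<eta>::real. \<eta> > 0 \<and> (\<exists>K\<in>sets M. emeasure M K < \<infinity> \<and>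
      (\<forall>A\<in>sets M. emeasure M A \<le> ennreal \<eta> \<longrightarrow>
        (SUP u\<in>X. L1_norm M (\<lambda>\<omega>. u \<omega> * indicator A \<omega>)) < ennreal \<epsilon>) \<and>
      (SUP u\<in>X. L1_norm M (\<lambda>\<omega>. u \<omega> * indicator (space M - K) \<omega>)) < ennreal \<epsilon>)"
    using m \<epsilon> K_finite small outside
    by (intro exI[of _ "\<epsilon> / (2 * m)"] conjI bexI[of _ K]) auto
qed

lemma AE_norm_le_Linf_norm:
  assumes "x \<in> Linf M" and "Linf_norm M x \<le> ennreal b" and "0 \<le> b"
  shows "AE \<omega> in M. norm (x \<omega>) \<le> b"
proof -
  have [measurable]: "x \<in> borel_measurable M" using assms(1) by (simp add: Linf_def)
  have "AE \<omega> in M. ennreal (norm (x \<omega>)) \<le> Linf_norm M x"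
    unfolding Linf_norm_def by (rule esssup_AE)
  then show ?thesis
  proof eventually_elim
    case (elim \<omega>)
    then have "ennreal (norm (x \<omega>)) \<le> ennreal b" using assms(2) by (rule order.trans)
    then show ?case using assms(3) by simp
  qed
qed

text \<open>
  The minorant is linear in \<open>norm e\<close>, so after division by \<open>r\<close> the bound depends on \<open>r\<close> only
  through the requirement \<open>r * b \<le> \<eta>\<close>. As the bound is real, the negative part is
  finite even where the quotient itself is \<open>\<infinity>\<close>.
\<close>
lemma neg_part_quotient_le:
  fixes f :: "'a \<Rightarrow> 'e::real_normed_vector \<Rightarrow> ereal"
  assumes minorant: "\<And>e. norm e \<le> \<eta> \<Longrightarrow>
      f \<omega> (x0 \<omega> + e) - f \<omega> (x0 \<omega>) \<ge> ereal (- c * norm e)"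
    and r: "r > 0" and x: "norm (x \<omega>) \<le> b" and rb: "r * b \<le> \<eta>"
  shows "neg_part_quotient f x0 r x \<omega> \<le> ereal (b * \<bar>c\<bar>)"
proof -
  have "norm (r *\<^sub>R x \<omega>) = r * norm (x \<omega>)"
    using r by simp
  also have "\<dots> \<le> r * b"
    using r x by simp
  also note rb
  finally have "norm (r *\<^sub>R x \<omega>) \<le> \<eta>" .
  from minorant[OF this]
  have diff: "ereal (- c * (r * norm (x \<omega>))) \<le> f \<omega> (x0 \<omega> + r *\<^sub>R x \<omega>) - f \<omega> (x0 \<omega>)"
    using r by simp
  have "c * norm (x \<omega>) \<le> \<bar>c\<bar> * b"
    using x by (intro mult_mono) auto
  then have cb: "- (b * \<bar>c\<bar>) \<le> - c * norm (x \<omega>)" by (simp add: mult.commute)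
  have "ereal (- (b * \<bar>c\<bar>)) \<le> ereal (inverse r) * ereal (- c * (r * norm (x \<omega>)))"
    using cb r by (simp add: field_simps)
  also have "\<dots> \<le> ereal (inverse r) * (f \<omega> (x0 \<omega> + r *\<^sub>R x \<omega>) - f \<omega> (x0 \<omega>))"
    using r by (intro ereal_mult_left_mono diff) simp
  finally have "- (ereal (inverse r) * (f \<omega> (x0 \<omega> + r *\<^sub>R x \<omega>) - f \<omega> (x0 \<omega>)))
      \<le> ereal (b * \<bar>c\<bar>)"
    by (simp add: ereal_uminus_le_reorder)
  moreover have "0 \<le> b * \<bar>c\<bar>"
    using x norm_ge_zero[of "x \<omega>"] by (intro mult_nonneg_nonneg) linarith+
  ultimately show ?thesis
    by (simp add: neg_part_quotient_def)
qed

lemma borel_measurable_neg_part_quotient: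
  fixes f :: "'a \<Rightarrow> 'e::{banach, second_countable_topology} \<Rightarrow> ereal"
  assumes "measurable_integrand M f"
    and [measurable]: "x0 \<in> borel_measurable M" "x \<in> borel_measurable M"
  shows "neg_part_quotient f x0 r x \<in> borel_measurable M"
proof -
  have f: "(\<lambda>\<omega>. f \<omega> (y \<omega>)) \<in> borel_measurable M" if "y \<in> borel_measurable M" for y
  proof -
    have "(\<lambda>\<omega>. (\<omega>, y \<omega>)) \<in> measurable M (M \<Otimes>\<^sub>M borel)" using that by measurable
    from measurable_compose[OF this assms(1)[unfolded measurable_integrand_def]]
    show ?thesis by simp
  qed
  have [measurable]: "(\<lambda>\<omega>. f \<omega> (x0 \<omega> + r *\<^sub>R x \<omega>)) \<in> borel_measurable M"
    "(\<lambda>\<omega>. f \<omega> (x0 \<omega>)) \<in> borel_measurable M"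
    by (intro f; measurable)+
  show ?thesis
    unfolding neg_part_quotient_def[abs_def] by measurable
qed

theorem corollary8p17:
  fixes M :: "'a measure"
    and f :: "'a \<Rightarrow> 'e::{banach, second_countable_topology} \<Rightarrow> ereal"
    and x0 :: "'a \<Rightarrow> 'e"
    and c :: "'a \<Rightarrow> real"
    and \<eta> :: real
  assumes "sigma_finite_measure M"
    and "complete_measure M"
    and "measurable_integrand M f"
    and "x0 \<in> Linf M"
    and "AE \<omega> in M. \<bar>f \<omega> (x0 \<omega>)\<bar> \<noteq> \<infinity>"
    and "\<eta> > 0"
    and "integrable M c"
    and "AE \<omega> in M. \<forall>e. norm e \<le> \<eta> \<longrightarrow>
           f \<omega> (x0 \<omega> + e) - f \<omega> (x0 \<omega>) \<ge> ereal (- c \<omega> * norm e)"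
  shows "frechet_diff_lower_compactness M f x0"
  unfolding frechet_diff_lower_compactness_def
proof (intro allI impI)
  fix r :: "nat \<Rightarrow> real" and x :: "nat \<Rightarrow> 'a \<Rightarrow> 'e"
  assume r: "\<forall>n. r n > 0" "r \<longlonglongrightarrow> 0"
    and x: "\<forall>n. x n \<in> Linf M" and bounded: "(SUP n. Linf_norm M (x n)) < \<infinity>"
  define b where "b = enn2real (SUP n. Linf_norm M (x n))"
  have b: "0 \<le> b" "Linf_norm M (x n) \<le> ennreal b" for n
    using bounded SUP_upper[of n UNIV "\<lambda>n. Linf_norm M (x n)"] by (auto simp: b_def)
  have "(\<lambda>n. r n * b) \<longlonglongrightarrow> 0"
    using tendsto_mult_left_zero[OF r(2)] .
  then have "\<forall>\<^sub>F n in sequentially. r n * b < \<eta>"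
    using \<open>\<eta> > 0\<close> by (rule order_tendstoD)
  then obtain n0 where n0: "\<And>n. n \<ge> n0 \<Longrightarrow> r n * b \<le> \<eta>"
    by (force simp: eventually_sequentially)
  define q where "q n = neg_part_quotient f x0 (r n) (x n)" for n
  have q_le: "AE \<omega> in M. q n \<omega> \<le> ereal (b * \<bar>c \<omega>\<bar>)" if "n \<ge> n0" for n
    using assms(8) AE_norm_le_Linf_norm[OF x[rule_format] b(2) b(1), of n]
  proof eventually_elim
    case (elim \<omega>)
    show ?case
      unfolding q_def
      by (rule neg_part_quotient_le[where \<eta> = \<eta>]) (use elim r(1) n0[OF that] in auto)
  qed
  have q_nonneg: "0 \<le> q n \<omega>" for n \<omega>
    by (simp add: q_def neg_part_quotient_def)
  have [measurable]: "q n \<in> borel_measurable M" for n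
    unfolding q_def
    by (rule borel_measurable_neg_part_quotient[OF assms(3)])
      (use assms(4) x in \<open>auto simp: Linf_def\<close>)
  have q_dom: "AE \<omega> in M. \<bar>real_of_ereal (q n \<omega>)\<bar> \<le> b * \<bar>c \<omega>\<bar>" if "n \<ge> n0" for n
    using q_le[OF that]
  proof eventually_elim
    case (elim \<omega>)
    then show ?case using q_nonneg[of n \<omega>] by (cases "q n \<omega>") auto
  qed
  have "uniformly_integrable M ((\<lambda>n \<omega>. real_of_ereal (q n \<omega>)) ` {n0..})"
  proof (rule uniformly_integrable_dominated)
    show "integrable M (\<lambda>\<omega>. b * \<bar>c \<omega>\<bar>)" using assms(7) by simp
  qed (use q_dom b(1) in auto)
  moreover have "AE \<omega> in M. q n \<omega> < \<infinity>" if "n \<ge> n0" for n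
    using q_le[OF that] by eventually_elim auto
  ultimately show "\<exists>n0. (\<forall>n\<ge>n0. AE \<omega> in M. neg_part_quotient f x0 (r n) (x n) \<omega> < \<infinity>) \<and>
      uniformly_integrable M
        ((\<lambda>n \<omega>. real_of_ereal (neg_part_quotient f x0 (r n) (x n) \<omega>)) ` {n0..})"
    unfolding q_def by blast
qed

end
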